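(* Let $\mathcal{X}\subseteq\mathbb{R}^d$ be a nonempty convex set (not necessarily closed) equipped with a regular Finsler metric with local norms $\|\cdot\|_x$ and dual local norms $\|\cdot\|_{x,*}$, let $h$ be a Bregman-Finsler function on $\mathcal{X}$ with strong convexity modulus $K>0$ and Bregman divergence $D$, and let $V:\mathcal{X}\to\mathbb{R}^d$ be monotone, i.e. $\langle V(x)-V(x'),x-x'\rangle\ge0$ for all $x,x'\in\mathcal{X}$. Let $\mathcal{C}\subseteq\mathcal{X}$ be a convex compact neighborhood (in $\mathcal{X}$) of a solution of the variational inequality (VI) associated with $V$ and $\mathcal{X}$, and set $H=\sup_{x\in\mathcal{C}}D(x,X_1)$. Then the ergodic average $\bar X_T$ of the AdaProx algorithm started at $X_1\in\mathcal{X}$ satisfies the following. (a) If $V$ is metrically bounded, i.e. there is $M>0$ with $\|V(x)\|_{x,*}\le M$ for all $x\in\mathcal{X}$, then $$\mathrm{Gap}_{\mathcal{C}}(\bar X_T)=\mathcal{O}\left(\frac{H+M^3(1+1/K)^2+\log\bigl(1+4M^2(1+2/K)^2T\bigr)}{\sqrt{T}}\right).$$ (b) If $V$ is metrically smooth, i.e. there is $L>0$ with $\|V(x')-V(x)\|_{x,*}\le L\|x'-x\|_{x'}$ for all $x,x'\in\mathcal{X}$, then $$\mathrm{Gap}_{\mathcal{C}}(\bar X_T)=\mathcal{O}\left(H/T\right).$$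
   Context: Variational inequality (VI): a solution is a point $x^*\in\mathcal{X}$ such that $\langle V(x^* ),x-x^*\rangle\ge0$ for all $x\in\mathcal{X}$. Restricted merit function: for a nonempty convex $\mathcal{C}\subseteq\mathcal{X}$ and $\hat x\in\mathcal{X}$, $\mathrm{Gap}_{\mathcal{C}}(\hat x)=\sup_{x\in\mathcal{C}}\langle V(x),\hat x-x\rangle$. Finsler metric: a continuous function $F:\mathcal{X}\times\mathbb{R}^d\to\mathbb{R}_+$ such that for all $x\in\mathcal{X}$, $z,z'\in\mathbb{R}^d$, $\lambda\in\mathbb{R}$: $F(x;z+z')\le F(x;z)+F(x;z')$; $F(x;\lambda z)=|\lambda|F(x;z)$; $F(x;z)\ge0$ with equality iff $z=0$. The local norms are $\|z\|_x=F(x;z)$ and $\|v\|_{x,*}=\max\{\langle v,z\rangle:F(x;z)=1\}$. The metric is regular if $\|v\|_{x',*}/\|v\|_{x,*}=1+\mathcal{O}(\|x'-x\|_x)$ for all $x,x'\in\mathcal{X}$, $v\in\mathbb{R}^d\setminus\{0\}$, i.e. there is $\beta>0$ such that $\|v\|_{x',*}/\|v\|_{x,*}\le1+\beta\|x'-x\|_x$ for all such $x,x',v$. It is also assumed throughout that there is $\nu>0$ with $\|\cdot\|_x\ge\nu\|\cdot\|$ for all $x\in\mathcal{X}$, where $\|\cdot\|$ is a fixed reference norm on $\mathbb{R}^d$. Bregman-Finsler function on $\mathcal{X}$: a function $h:\mathbb{R}^d\to\mathbb{R}\cup\{\infty\}$ such that (1) $h$ is convex, lower semicontinuous, $\mathrm{cl}(\mathrm{dom}\,h)=\mathrm{cl}(\mathcal{X})$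 and $\mathrm{dom}\,\partial h=\mathcal{X}$; (2) the subdifferential of $h$ admits a continuous selection $\nabla h(x)\in\partial h(x)$, $x\in\mathcal{X}$; (3) there is $K>0$ with $h(x')\ge h(x)+\langle\nabla h(x),x'-x\rangle+\frac K2\|x'-x\|_x^2$ for all $x\in\mathcal{X}$, $x'\in\mathrm{dom}\,h$. The Bregman divergence is $D(x',x)=h(x')-h(x)-\langle\nabla h(x),x'-x\rangle$ for $x\in\mathcal{X}$, $x'\in\mathrm{dom}\,h$, and the prox-mapping is $P_x(y)=\arg\min_{x'\in\mathcal{X}}\{\langle y,x-x'\rangle+D(x',x)\}$ for $x\in\mathcal{X}$, $y\in\mathbb{R}^d$. AdaProx algorithm: starting from $X_1\in\mathcal{X}$ and $\gamma_1=1$, for $t=1,2,\dots$ set $$X_{t+1/2}=P_{X_t}(-\gamma_tV(X_t)),\quad X_{t+1}=P_{X_t}(-\gamma_tV(X_{t+1/2})),$$ $$\delta_t=\|V(X_{t+1/2})-V(X_t)\|_{X_{t+1/2},*},\quad \gamma_{t+1}=1\Big/\sqrt{1+\textstyle\sum_{s=1}^t\delta_s^2}.$$ Ergodic average: $\bar X_T=\sum_{t=1}^{T}\gamma_tX_{t+1/2}\big/\sum_{t=1}^{T}\gamma_t$. The notation $\mathcal{O}(\cdot)$ in the bounds refers to $T\to\infty$; the implied multiplicative constant does not depend on $T$ but may depend on the problem's data. *)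

theory Defs
  imports "HOL-Analysis.Analysis" "HOL-Library.Landau_Symbols"
begin

section \<open>Variational inequalities\<close>

definition vi_solution :: "('a::real_inner \<Rightarrow> 'a) \<Rightarrow> 'a set \<Rightarrow> 'a \<Rightarrow> bool" where
  "vi_solution V X xs \<longleftrightarrow> xs \<in> X \<and> (\<forall>x\<in>X. V xs \<bullet> (x - xs) \<ge> 0)"

definition monotone_operator :: "'a::real_inner set \<Rightarrow> ('a \<Rightarrow> 'a) \<Rightarrow> bool" where
  "monotone_operator X V \<longleftrightarrow> (\<forall>x\<in>X. \<forall>x'\<in>X. (V x - V x') \<bullet> (x - x') \<ge> 0)"

text \<open>A real supremum. It is meaningful when \<open>C\<close> is nonempty and the values are bounded above;
  for compact \<open>C\<close> the latter holds if \<open>V\<close> is metrically bounded or metrically smooth (see below).\<close>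

definition Gap :: "('a::real_inner \<Rightarrow> 'a) \<Rightarrow> 'a set \<Rightarrow> 'a \<Rightarrow> real" where
  "Gap V C y = (SUP x\<in>C. V x \<bullet> (y - x))"

section \<open>Finsler metrics\<close>

definition is_norm :: "('a::real_vector \<Rightarrow> real) \<Rightarrow> bool" where
  "is_norm N \<longleftrightarrow>
     (\<forall>z z'. N (z + z') \<le> N z + N z') \<and>
     (\<forall>c z. N (c *\<^sub>R z) = \<bar>c\<bar> * N z) \<and>
     (\<forall>z. N z \<ge> 0 \<and> (N z = 0 \<longleftrightarrow> z = 0))"

definition finsler_metric :: "'a::euclidean_space set \<Rightarrow> ('a \<Rightarrow> 'a \<Rightarrow> real) \<Rightarrow> bool" where
  "finsler_metric X F \<longleftrightarrow>
     continuous_on (X \<times> UNIV) (\<lambda>(x, z). F x z) \<and> (\<forall>x\<in>X. is_norm (F x))"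

text \<open>The supremum is attained when \<open>F x\<close> is a norm, since the unit sphere of \<open>F x\<close> is then
  compact and nonempty.\<close>

definition dual_norm :: "('a::euclidean_space \<Rightarrow> 'a \<Rightarrow> real) \<Rightarrow> 'a \<Rightarrow> 'a \<Rightarrow> real" where
  "dual_norm F x v = (SUP z\<in>{z. F x z = 1}. v \<bullet> z)"

definition regular_metric :: "'a::euclidean_space set \<Rightarrow> ('a \<Rightarrow> 'a \<Rightarrow> real) \<Rightarrow> bool" where
  "regular_metric X F \<longleftrightarrow>
     (\<exists>\<beta>>0. \<forall>x\<in>X. \<forall>x'\<in>X. \<forall>v. v \<noteq> 0 \<longrightarrow>
        dual_norm F x' v / dual_norm F x v \<le> 1 + \<beta> * F x (x' - x))"

definition metrically_bounded ::
  "'a::euclidean_space set \<Rightarrow> ('a \<Rightarrow> 'a \<Rightarrow> real) \<Rightarrow> ('a \<Rightarrow> 'a) \<Rightarrow> real \<Rightarrow> bool" where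
  "metrically_bounded X F V M \<longleftrightarrow> (\<forall>x\<in>X. dual_norm F x (V x) \<le> M)"

definition metrically_smooth ::
  "'a::euclidean_space set \<Rightarrow> ('a \<Rightarrow> 'a \<Rightarrow> real) \<Rightarrow> ('a \<Rightarrow> 'a) \<Rightarrow> real \<Rightarrow> bool" where
  "metrically_smooth X F V L \<longleftrightarrow>
     (\<forall>x\<in>X. \<forall>x'\<in>X. dual_norm F x (V x' - V x) \<le> L * F x' (x' - x))"

section \<open>Bregman-Finsler functions\<close>

text \<open>Functions \<open>\<real>\<^sup>d \<rightarrow> \<real> \<union> {\<infinity>}\<close> are represented as \<^typ>\<open>ereal\<close>-valued functions that
  nowhere take the value \<open>-\<infinity>\<close>.\<close>

definition edom :: "('a \<Rightarrow> ereal) \<Rightarrow> 'a set" where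
  "edom h = {x. h x < \<infinity>}"

definition econvex :: "('a::real_vector \<Rightarrow> ereal) \<Rightarrow> bool" where
  "econvex h \<longleftrightarrow>
     (\<forall>x y. \<forall>u>0. \<forall>v>0. u + v = 1 \<longrightarrow>
        h (u *\<^sub>R x + v *\<^sub>R y) \<le> ereal u * h x + ereal v * h y)"

definition lower_semicontinuous :: "('a::topological_space \<Rightarrow> ereal) \<Rightarrow> bool" where
  "lower_semicontinuous h \<longleftrightarrow> (\<forall>x. h x \<le> Liminf (at x) h)"

definition subdifferential :: "('a::real_inner \<Rightarrow> ereal) \<Rightarrow> 'a \<Rightarrow> 'a set" where
  "subdifferential h x =
     {v. x \<in> edom h \<and> (\<forall>x'. h x' \<ge> h x + ereal (v \<bullet> (x' - x)))}"

text \<open>The selection \<open>g\<close> of the subdifferential (written \<open>\<nabla>h\<close> in the literature) and the modulus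
  \<open>K\<close> are parameters, because the Bregman divergence depends on the former.\<close>

definition bregman_finsler ::
  "'a::euclidean_space set \<Rightarrow> ('a \<Rightarrow> 'a \<Rightarrow> real) \<Rightarrow> ('a \<Rightarrow> ereal) \<Rightarrow> ('a \<Rightarrow> 'a) \<Rightarrow> real \<Rightarrow> bool" where
  "bregman_finsler X F h g K \<longleftrightarrow>
     (\<forall>x. h x \<noteq> -\<infinity>) \<and>
     econvex h \<and> lower_semicontinuous h \<and>
     closure (edom h) = closure X \<and>
     {x. subdifferential h x \<noteq> {}} = X \<and>
     continuous_on X g \<and> (\<forall>x\<in>X. g x \<in> subdifferential h x) \<and>
     K > 0 \<and>
     (\<forall>x\<in>X. \<forall>x'\<in>edom h.
        h x' \<ge> h x + ereal (g x \<bullet> (x' - x)) + ereal (K / 2 * (F x (x' - x))\<^sup>2))"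

text \<open>Only used for \<open>x' \<in> edom h\<close> and \<open>x \<in> X \<subseteq> edom h\<close>, where \<open>h\<close> is finite.\<close>

definition bregman_div :: "('a::real_inner \<Rightarrow> ereal) \<Rightarrow> ('a \<Rightarrow> 'a) \<Rightarrow> 'a \<Rightarrow> 'a \<Rightarrow> real" where
  "bregman_div h g x' x = real_of_ereal (h x') - real_of_ereal (h x) - g x \<bullet> (x' - x)"

definition prox ::
  "'a::real_inner set \<Rightarrow> ('a \<Rightarrow> ereal) \<Rightarrow> ('a \<Rightarrow> 'a) \<Rightarrow> 'a \<Rightarrow> 'a \<Rightarrow> 'a" where
  "prox X h g x y = arg_min_on (\<lambda>x'. y \<bullet> (x - x') + bregman_div h g x' x) X"

section \<open>The AdaProx algorithm\<close>

text \<open>\<open>x t\<close>, \<open>y t\<close>, \<open>\<gamma> t\<close> and \<open>\<delta> t\<close> stand for \<open>X\<^sub>t\<close>, \<open>X\<^bsub>t+1/2\<^esub>\<close>, \<open>\<gamma>\<^sub>t\<close> and \<open>\<delta>\<^sub>t\<close>. Indices start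
  at \<open>1\<close>; the entries at index \<open>0\<close> are irrelevant.\<close>

definition adaprox ::
  "'a::euclidean_space set \<Rightarrow> ('a \<Rightarrow> 'a \<Rightarrow> real) \<Rightarrow> ('a \<Rightarrow> ereal) \<Rightarrow> ('a \<Rightarrow> 'a) \<Rightarrow> ('a \<Rightarrow> 'a) \<Rightarrow> 'a \<Rightarrow>
   (nat \<Rightarrow> 'a) \<Rightarrow> (nat \<Rightarrow> 'a) \<Rightarrow> (nat \<Rightarrow> real) \<Rightarrow> (nat \<Rightarrow> real) \<Rightarrow> bool" where
  "adaprox X F h g V X1 x y \<gamma> \<delta> \<longleftrightarrow>
     x 1 = X1 \<and> \<gamma> 1 = 1 \<and>
     (\<forall>t\<ge>1.
        y t = prox X h g (x t) (- (\<gamma> t *\<^sub>R V (x t))) \<and>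
        x (t + 1) = prox X h g (x t) (- (\<gamma> t *\<^sub>R V (y t))) \<and>
        \<delta> t = dual_norm F (y t) (V (y t) - V (x t)) \<and>
        \<gamma> (t + 1) = 1 / sqrt (1 + (\<Sum>s=1..t. (\<delta> s)\<^sup>2)))"

definition ergodic_average :: "(nat \<Rightarrow> real) \<Rightarrow> (nat \<Rightarrow> 'a::real_vector) \<Rightarrow> nat \<Rightarrow> 'a" where
  "ergodic_average \<gamma> y T = (\<Sum>t=1..T. \<gamma> t *\<^sub>R y t) /\<^sub>R (\<Sum>t=1..T. \<gamma> t)"

end

theory Submission
  imports Defs
begin

text \<open>
  Existence of the prox steps follows from strong convexity and lower semicontinuity of \<open>h\<close>.
  The three-point identity, applied to the two prox steps of an iteration, and Young's inequality for
  \<open>\<gamma>\<^sub>t \<langle>V(X\<^bsub>t+1/2\<^esub>) - V(X\<^sub>t), X\<^bsub>t+1/2\<^esub> - X\<^bsub>t+1\<^esub>\<rangle>\<close>, measured in the local norm at \<open>X\<^bsub>t+1/2\<^esub>\<close>, give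
  \<open>\<gamma>\<^sub>t \<langle>V(X\<^bsub>t+1/2\<^esub>), X\<^bsub>t+1/2\<^esub> - q\<rangle> \<le> D(q, X\<^sub>t) - D(q, X\<^bsub>t+1\<^esub>) + \<gamma>\<^sub>t\<^sup>2\<delta>\<^sub>t\<^sup>2 / (2K) - D(X\<^bsub>t+1/2\<^esub>, X\<^sub>t).\<close>
  Hence the gap at the ergodic average is at most \<open>(H + \<Sum> \<gamma>\<^sub>t\<^sup>2\<delta>\<^sub>t\<^sup>2 / (2K)) / \<Sum> \<gamma>\<^sub>t\<close>, and it is nonnegative
  because the solution lies in \<open>C\<close>. If \<open>V\<close> is metrically bounded, regularity of the metric bounds
  \<open>\<delta>\<^sub>t\<close>, so the error sum grows logarithmically and \<open>\<Sum> \<gamma>\<^sub>t\<close> like \<open>\<surd>T\<close>. If \<open>V\<close> is metrically smooth,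
  \<open>\<delta>\<^sub>t\<^sup>2\<close> is dominated by \<open>D(X\<^bsub>t+1/2\<^esub>, X\<^sub>t)\<close>; taking \<open>q\<close> to be a solution shows that \<open>\<Sum> \<delta>\<^sub>t\<^sup>2\<close> converges,
  so the step sizes stay bounded away from zero.\<close>

section \<open>Dual norms\<close>

context
  fixes F :: "'a::euclidean_space \<Rightarrow> 'a \<Rightarrow> real" and x :: 'a
  assumes norm: "is_norm (F x)" and cont: "continuous_on UNIV (F x)"
begin

lemma local_norm_scale: "F x (c *\<^sub>R z) = \<bar>c\<bar> * F x z"
  using norm by (simp add: is_norm_def)

lemma local_norm_pos: "z \<noteq> 0 \<Longrightarrow> F x z > 0"
  using norm by (simp add: is_norm_def order_less_le)

text \<open>Compactness gives a positive minimum of \<open>F x\<close> on the Euclidean unit sphere;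
  homogeneity extends it. This bounds the unit sphere of \<open>F x\<close>, so that the supremum in
  \<open>dual_norm\<close> is finite.\<close>

lemma local_norm_lower_bound: "\<exists>m>0. \<forall>z. m * norm z \<le> F x z"
proof -
  have "sphere 0 1 \<noteq> ({} :: 'a set)" by (simp add: sphere_eq_empty)
  then obtain u where u: "u \<in> sphere 0 1" "\<And>z. z \<in> sphere 0 1 \<Longrightarrow> F x u \<le> F x z"
    using continuous_attains_inf[OF compact_sphere _ continuous_on_subset[OF cont subset_UNIV]]
    by blast
  have "u \<noteq> 0" using u(1) by auto
  then have pos: "F x u > 0" by (rule local_norm_pos)
  have "F x u * norm z \<le> F x z" for z
  proof (cases "z = 0")
    case True
    then show ?thesis using norm by (simp add: is_norm_def)
  next
    case False
    have "F x u \<le> F x ((1 / norm z) *\<^sub>R z)" using u(2) False by simp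
    also have "\<dots> = F x z / norm z" by (simp add: local_norm_scale)
    finally show ?thesis using False by (simp add: field_simps)
  qed
  with pos show ?thesis by blast
qed

lemma local_norm_minus: "F x (- z) = F x z"
  using local_norm_scale[of "-1" z] by simp

lemma local_norm_minus_commute: "F x (z - w) = F x (w - z)"
  using local_norm_minus[of "w - z"] by simp

lemma local_unit_sphere_nonempty: "{z. F x z = 1} \<noteq> {}"
proof -
  obtain u :: 'a where "u \<noteq> 0" using nonempty_Basis nonzero_Basis by blast
  then have "F x u > 0" by (rule local_norm_pos)
  then have "F x ((1 / F x u) *\<^sub>R u) = 1" unfolding local_norm_scale by simp
  then show ?thesis by blast
qed

lemma inner_le_dual_norm: "v \<bullet> z \<le> dual_norm F x v * F x z"
proof -
  obtain m where m: "m > 0" "\<And>z. m * norm z \<le> F x z"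
    using local_norm_lower_bound by blast
  have bdd: "bdd_above ((\<bullet>) v ` {z. F x z = 1})"
  proof (rule bdd_aboveI2)
    fix z assume "z \<in> {z. F x z = 1}"
    then have "norm z \<le> 1 / m" using m(2)[of z] m(1) by (simp add: field_simps)
    then show "v \<bullet> z \<le> norm v * (1 / m)"
      by (meson mult_left_mono norm_cauchy_schwarz norm_ge_zero order_trans)
  qed
  show ?thesis
  proof (cases "z = 0")
    case True
    moreover have "F x 0 = 0" using norm by (simp add: is_norm_def)
    ultimately show ?thesis by simp
  next
    case False
    then have pos: "F x z > 0" by (rule local_norm_pos)
    then have "F x ((1 / F x z) *\<^sub>R z) = 1" unfolding local_norm_scale by simp
    then have "v \<bullet> ((1 / F x z) *\<^sub>R z) \<le> dual_norm F x v"
      unfolding dual_norm_def by (intro cSUP_upper[OF _ bdd]) simp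
    then show ?thesis using pos by (simp add: field_simps)
  qed
qed

lemma dual_norm_le:
  assumes "\<And>z. F x z = 1 \<Longrightarrow> v \<bullet> z \<le> B"
  shows "dual_norm F x v \<le> B"
  unfolding dual_norm_def using local_unit_sphere_nonempty assms by (intro cSUP_least) auto

lemma dual_norm_zero: "dual_norm F x 0 = 0"
  unfolding dual_norm_def using local_unit_sphere_nonempty by simp

lemma dual_norm_pos:
  assumes "v \<noteq> 0"
  shows "dual_norm F x v > 0"
proof -
  have "0 < v \<bullet> v" using assms by simp
  also have "\<dots> \<le> dual_norm F x v * F x v" by (rule inner_le_dual_norm)
  finally show ?thesis
    using local_norm_pos[OF assms] by (rule zero_less_mult_pos2)
qed

lemma dual_norm_nonneg: "dual_norm F x v \<ge> 0"
  using dual_norm_pos[of v] dual_norm_zero by (cases "v = 0") auto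

lemma dual_norm_diff_le: "dual_norm F x (v - w) \<le> dual_norm F x v + dual_norm F x w"
proof (rule dual_norm_le)
  fix z assume "F x z = 1"
  then show "(v - w) \<bullet> z \<le> dual_norm F x v + dual_norm F x w"
    using inner_le_dual_norm[of v z] inner_le_dual_norm[of w "- z"] local_norm_minus[of z]
    by (simp add: inner_diff_left)
qed

lemma dual_norm_minus_commute: "dual_norm F x (v - w) = dual_norm F x (w - v)"
proof -
  have "dual_norm F x (- u) \<le> dual_norm F x u" for u
    using dual_norm_diff_le[of 0 u] dual_norm_zero by simp
  from this[of "v - w"] this[of "w - v"] show ?thesis by simp
qed

end

section \<open>The prox-mapping\<close>

locale bregman_geometry =
  fixes X :: "'a::euclidean_space set" and F :: "'a \<Rightarrow> 'a \<Rightarrow> real"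
    and h :: "'a \<Rightarrow> ereal" and g :: "'a \<Rightarrow> 'a" and K :: real
  assumes convex: "convex X"
    and finsler: "finsler_metric X F"
    and bregman: "bregman_finsler X F h g K"
begin

abbreviation D :: "'a \<Rightarrow> 'a \<Rightarrow> real" where
  "D \<equiv> bregman_div h g"

lemma K_pos: "K > 0"
  using bregman by (simp add: bregman_finsler_def)

lemma local_norm: "p \<in> X \<Longrightarrow> is_norm (F p)"
  using finsler by (simp add: finsler_metric_def)

lemma local_norm_continuous:
  assumes "p \<in> X"
  shows "continuous_on UNIV (F p)"
proof -
  have "continuous_on UNIV ((\<lambda>(x, z). F x z) \<circ> (\<lambda>z. (p, z)))"
    using finsler assms unfolding finsler_metric_def
    by (intro continuous_on_compose continuous_intros) (auto elim: continuous_on_subset)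
  then show ?thesis by (simp add: o_def)
qed

text \<open>The norm axioms and continuity are discharged separately, leaving two identical
  membership premises; hence the doubled facts such as \<open>[OF xt xt]\<close> later.\<close>

lemmas norm_lower_bound = local_norm_lower_bound[where F = F, OF local_norm local_norm_continuous]
  and norm_minus_commute = local_norm_minus_commute[where F = F, OF local_norm local_norm_continuous]
  and inner_le = inner_le_dual_norm[where F = F, OF local_norm local_norm_continuous]
  and dual_zero = dual_norm_zero[where F = F, OF local_norm local_norm_continuous]
  and dual_pos = dual_norm_pos[where F = F, OF local_norm local_norm_continuous]
  and dual_nonneg = dual_norm_nonneg[where F = F, OF local_norm local_norm_continuous]
  and dual_diff_le = dual_norm_diff_le[where F = F, OF local_norm local_norm_continuous]
  and dual_minus_commute = dual_norm_minus_commute[where F = F, OF local_norm local_norm_continuous]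

section \<open>Strong convexity and the Bregman divergence\<close>

lemma domain_subset: "X \<subseteq> edom h"
  using bregman unfolding bregman_finsler_def subdifferential_def by blast

lemma h_real: "p \<in> edom h \<Longrightarrow> h p = ereal (real_of_ereal (h p))"
  using bregman unfolding bregman_finsler_def edom_def
  by (metis ereal_real ereal_infty_less(1) mem_Collect_eq real_of_ereal.elims)

lemma subgradient_ineq:
  assumes "p \<in> X" "q \<in> X"
  shows "real_of_ereal (h q) \<ge> real_of_ereal (h p) + g p \<bullet> (q - p)"
proof -
  have "h q \<ge> h p + ereal (g p \<bullet> (q - p))"
    using bregman assms unfolding bregman_finsler_def subdifferential_def by blast
  moreover have "h p = ereal (real_of_ereal (h p))" "h q = ereal (real_of_ereal (h q))"
    using h_real domain_subset assms by blast+
  ultimately show ?thesis by (metis ereal_less_eq(3) plus_ereal.simps(1))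
qed

text \<open>Outside \<open>edom h\<close> the value of \<open>h\<close> is infinite, so the bound
  holds on the whole space. The sublevel sets used for existence are not known in advance to lie in
  \<open>X\<close>.\<close>

lemma strong_convexity_ereal:
  assumes "p \<in> X"
  shows "h q \<ge> ereal (real_of_ereal (h p) + g p \<bullet> (q - p) + K / 2 * (F p (q - p))\<^sup>2)"
proof (cases "q \<in> edom h")
  case True
  have "h q \<ge> h p + ereal (g p \<bullet> (q - p)) + ereal (K / 2 * (F p (q - p))\<^sup>2)"
    using bregman assms True unfolding bregman_finsler_def by blast
  moreover have "h p = ereal (real_of_ereal (h p))"
    using h_real domain_subset assms by blast
  ultimately show ?thesis by (metis plus_ereal.simps(1))
next
  case False
  then show ?thesis by (simp add: edom_def)
qed

lemma D_lower_bound: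
  assumes "p \<in> X" "q \<in> X"
  shows "D q p \<ge> K / 2 * (F p (q - p))\<^sup>2"
proof -
  have "h q = ereal (real_of_ereal (h q))" using h_real domain_subset assms by blast
  then have "real_of_ereal (h p) + g p \<bullet> (q - p) + K / 2 * (F p (q - p))\<^sup>2 \<le> real_of_ereal (h q)"
    using strong_convexity_ereal[OF assms(1), of q] by (metis ereal_less_eq(3))
  then show ?thesis by (simp add: bregman_div_def)
qed

lemma D_nonneg: "p \<in> X \<Longrightarrow> q \<in> X \<Longrightarrow> D q p \<ge> 0"
  using D_lower_bound[of p q] K_pos
  by (meson dual_order.trans half_gt_zero less_eq_real_def mult_nonneg_nonneg zero_le_power2)

lemma D_self: "D p p = 0"
  by (simp add: bregman_div_def)

lemma three_point:
  "D q x = D q p + D p x + (g p - g x) \<bullet> (q - p)"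
  by (simp add: bregman_div_def inner_diff_left inner_diff_right)

section \<open>Existence and optimality of prox steps\<close>

lemma closed_sublevel: "closed {z. h z \<le> ereal (w \<bullet> z + c)}"
proof -
  have "open {z. h z > ereal (w \<bullet> z + c)}"
  proof (subst open_subopen, clarify)
    fix z0 assume "ereal (w \<bullet> z0 + c) < h z0"
    \<comment> \<open>A real \<open>r\<close> strictly between both values separates them on a
      neighborhood: \<open>h\<close> stays above it by lower semicontinuity, the affine function
      stays below it.\<close>
    then obtain r where r: "w \<bullet> z0 + c < r" "ereal r < h z0"
      using ereal_dense2 by fastforce
    have "ereal r < Liminf (at z0) h"
      using r(2) bregman unfolding bregman_finsler_def lower_semicontinuous_def
      by (meson less_le_trans)
    then have 1: "eventually (\<lambda>z. ereal r < h z) (at z0)" by (rule less_LiminfD)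
    have "((\<lambda>z. w \<bullet> z + c) \<longlongrightarrow> w \<bullet> z0 + c) (at z0)" by (intro tendsto_intros)
    then have 2: "eventually (\<lambda>z. w \<bullet> z + c < r) (at z0)" using r(1) by (rule order_tendstoD(2))
    have "eventually (\<lambda>z. ereal (w \<bullet> z + c) < h z) (at z0)"
      using 1 2 by eventually_elim (metis less_ereal.simps(1) less_trans)
    \<comment> \<open>\<open>Liminf (at z0)\<close> ignores the point \<open>z0\<close> itself,
      which is added here.\<close>
    then have "eventually (\<lambda>z. ereal (w \<bullet> z + c) < h z) (nhds z0)"
      using \<open>ereal (w \<bullet> z0 + c) < h z0\<close> by (simp add: eventually_nhds_conv_at)
    then show "\<exists>T. open T \<and> z0 \<in> T \<and> T \<subseteq> {z. ereal (w \<bullet> z + c) < h z}"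
      by (auto simp: eventually_nhds)
  qed
  moreover have "{z. h z > ereal (w \<bullet> z + c)} = - {z. h z \<le> ereal (w \<bullet> z + c)}" by auto
  ultimately show ?thesis by (simp add: closed_def)
qed

text \<open>Since \<open>X\<close> may fail to be closed, the minimization runs over the whole
  space, by nested compact sublevel sets. The minimizer returns to \<open>X\<close> because
  \<open>X\<close> is exactly the set where \<open>h\<close> has a subgradient.\<close>

lemma prox_minimizer_exists:
  assumes x: "x \<in> X"
  shows "\<exists>p\<in>X. \<forall>q\<in>X. v \<bullet> (x - p) + D p x \<le> v \<bullet> (x - q) + D q x"
proof -
  obtain m where m: "m > 0" "\<And>z. m * norm z \<le> F x z"
    using norm_lower_bound[OF x x] by blast
  define k where "k = K / 2 * m\<^sup>2"
  have k: "k > 0" using K_pos m(1) by (simp add: k_def)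
  \<comment> \<open>The prox objective at \<open>q\<close> in \<open>X\<close> equals
    \<open>h q - l q\<close> with \<open>l\<close> affine, so \<open>S c\<close> is its sublevel set
    at level \<open>c\<close>.\<close>
  define l where "l z = real_of_ereal (h x) + (g x + v) \<bullet> (z - x)" for z
  define S where "S c = {z. h z \<le> ereal (l z + c)}" for c
  have S_eq: "S c = {z. h z \<le> ereal ((g x + v) \<bullet> z + (real_of_ereal (h x) - (g x + v) \<bullet> x + c))}" for c
    unfolding S_def l_def by (simp add: inner_diff_right algebra_simps)
  have closed_S: "closed (S c)" for c unfolding S_eq by (rule closed_sublevel)
  \<comment> \<open>Strong convexity at \<open>x\<close> cancels the \<open>g x\<close> part of
    \<open>l\<close>, leaving a quadratic against the linear term in \<open>v\<close>.\<close>
  have growth: "k * (norm (z - x))\<^sup>2 \<le> norm v * norm (z - x) + c" if "z \<in> S c" for z c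
  proof -
    have "ereal (real_of_ereal (h x) + g x \<bullet> (z - x) + K / 2 * (F x (z - x))\<^sup>2) \<le> ereal (l z + c)"
      using order_trans[OF strong_convexity_ereal[OF x, of z]] that unfolding S_def by blast
    then have "K / 2 * (F x (z - x))\<^sup>2 \<le> v \<bullet> (z - x) + c" by (simp add: l_def inner_add_left)
    moreover have "k * (norm (z - x))\<^sup>2 \<le> K / 2 * (F x (z - x))\<^sup>2"
      using power_mono[OF m(2)[of "z - x"], of 2] m(1) K_pos
      by (simp add: k_def power_mult_distrib mult.assoc)
    moreover have "v \<bullet> (z - x) \<le> norm v * norm (z - x)" by (rule norm_cauchy_schwarz)
    ultimately show ?thesis by linarith
  qed
  have young: "norm v * s \<le> k / 2 * s\<^sup>2 + (norm v)\<^sup>2 / (2 * k)" for s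
  proof -
    have "0 \<le> (k * s - norm v)\<^sup>2 / (2 * k)" using k by simp
    also have "\<dots> = k / 2 * s\<^sup>2 + (norm v)\<^sup>2 / (2 * k) - norm v * s"
      using k by (simp add: power2_eq_square field_simps)
    finally show ?thesis by simp
  qed
  have S_radius: "k / 2 * (norm (z - x))\<^sup>2 \<le> (norm v)\<^sup>2 / (2 * k) + c" if "z \<in> S c" for z c
    using growth[OF that] young[of "norm (z - x)"] by linarith
  have compact_S: "compact (S c)" for c
  proof -
    have "S c \<subseteq> cball x (sqrt (((norm v)\<^sup>2 / (2 * k) + c) / (k / 2)))"
    proof
      fix z assume "z \<in> S c"
      from S_radius[OF this] have "(norm (z - x))\<^sup>2 \<le> ((norm v)\<^sup>2 / (2 * k) + c) / (k / 2)"
        using k by (simp add: field_simps)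
      then show "z \<in> cball x (sqrt (((norm v)\<^sup>2 / (2 * k) + c) / (k / 2)))"
        by (simp add: dist_norm Real_Vector_Spaces.norm_minus_commute real_le_rsqrt)
    qed
    then show ?thesis
      using closed_S bounded_subset[OF bounded_cball] compact_eq_bounded_closed by blast
  qed
  define A where "A = {c. S c \<noteq> {}}"
  have "x \<in> S 0"
    using h_real domain_subset x by (auto simp: S_def l_def)
  then have A_ne: "A \<noteq> {}" by (auto simp: A_def)
  have A_bdd: "bdd_below A"
  proof (rule bdd_belowI)
    fix c assume "c \<in> A"
    then obtain z where "z \<in> S c" by (auto simp: A_def)
    from S_radius[OF this] show "- ((norm v)\<^sup>2 / (2 * k)) \<le> c"
      using k by (smt (verit) zero_le_power2 mult_nonneg_nonneg divide_nonneg_pos)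
  qed
  define c0 where "c0 = Inf A"
  \<comment> \<open>\<open>c0\<close> is the infimum of \<open>h - l\<close>. The sublevel sets just
    above it are nonempty, compact and nested, and a common point attains the infimum.\<close>
  have "\<Inter> (range (\<lambda>n. S (c0 + 1 / Suc n))) \<noteq> {}"
  proof (rule compact_nest)
    show "compact (S (c0 + 1 / Suc n))" for n by (rule compact_S)
    show "S (c0 + 1 / Suc n) \<noteq> {}" for n
    proof -
      have "Inf A < c0 + 1 / Suc n" by (simp add: c0_def)
      then obtain c where "c \<in> A" "c < c0 + 1 / Suc n"
        using cInf_lessD[OF A_ne] by blast
      moreover from this have "S c \<subseteq> S (c0 + 1 / Suc n)"
        unfolding S_def by (auto elim!: order_trans)
      ultimately show ?thesis by (auto simp: A_def)
    qed
    show "S (c0 + 1 / Suc n) \<subseteq> S (c0 + 1 / Suc n')" if "n' \<le> n" for n n'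
    proof -
      have "1 / real (Suc n) \<le> 1 / real (Suc n')" using that by (simp add: frac_le)
      then show ?thesis unfolding S_def by (auto elim!: order_trans)
    qed
  qed
  then obtain p where p: "\<And>n. p \<in> S (c0 + 1 / Suc n)" by blast
  have "h p \<le> ereal (l p + (c0 + 1 / Suc 0))" using p[of 0] by (simp add: S_def)
  then have p_dom: "p \<in> edom h" by (auto simp: edom_def intro: le_less_trans)
  have p_le: "real_of_ereal (h p) \<le> l p + c0"
  proof (rule LIMSEQ_le_const)
    show "(\<lambda>n. l p + (c0 + 1 / Suc n)) \<longlonglongrightarrow> l p + c0"
      using tendsto_add[OF tendsto_const LIMSEQ_inverse_real_of_nat_add[of c0], of "l p"]
      by (simp add: inverse_eq_divide)
    have "real_of_ereal (h p) \<le> l p + (c0 + 1 / Suc n)" for n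
      using p[of n] h_real[OF p_dom] unfolding S_def
      by (metis ereal_less_eq(3) mem_Collect_eq)
    then show "\<exists>n0. \<forall>n\<ge>n0. real_of_ereal (h p) \<le> l p + (c0 + 1 / Suc n)" by blast
  qed
  have ge: "l q + c0 \<le> real_of_ereal (h q)" if "q \<in> edom h" for q
  proof -
    have "q \<in> S (real_of_ereal (h q) - l q)" using h_real[OF that] by (simp add: S_def)
    then have "c0 \<le> real_of_ereal (h q) - l q"
      unfolding c0_def by (intro cInf_lower[OF _ A_bdd]) (auto simp: A_def)
    then show ?thesis by simp
  qed
  have min: "real_of_ereal (h p) - l p \<le> real_of_ereal (h q) - l q" if "q \<in> edom h" for q
    using p_le ge[OF that] by linarith
  \<comment> \<open>Minimality of \<open>h - l\<close> at \<open>p\<close> says that the slope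
    \<open>g x + v\<close> of \<open>l\<close> is a subgradient of \<open>h\<close> there.\<close>
  have "g x + v \<in> subdifferential h p"
  proof -
    have "h p + ereal ((g x + v) \<bullet> (q - p)) \<le> h q" for q
    proof (cases "q \<in> edom h")
      case True
      have "real_of_ereal (h p) + (g x + v) \<bullet> (q - p) \<le> real_of_ereal (h q)"
        using min[OF True] by (simp add: l_def inner_diff_right)
      then show ?thesis
        using h_real[OF True] h_real[OF p_dom] by (metis ereal_less_eq(3) plus_ereal.simps(1))
    next
      case False
      then show ?thesis by (simp add: edom_def)
    qed
    then show ?thesis using p_dom by (simp add: subdifferential_def)
  qed
  then have "p \<in> X" using bregman unfolding bregman_finsler_def by blast
  moreover have "v \<bullet> (x - p) + D p x \<le> v \<bullet> (x - q) + D q x" if "q \<in> X" for q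
    using min[of q] domain_subset that
    by (auto simp: bregman_div_def l_def inner_diff_right inner_add_left)
  ultimately show ?thesis by blast
qed

lemma prox_minimizes:
  fixes v :: 'a
  assumes "x \<in> X"
  defines "p \<equiv> prox X h g x v"
  shows "p \<in> X" and "q \<in> X \<Longrightarrow> v \<bullet> (x - p) + D p x \<le> v \<bullet> (x - q) + D q x"
proof -
  have "\<exists>p. is_arg_min (\<lambda>q. v \<bullet> (x - q) + D q x) (\<lambda>q. q \<in> X) p"
    using prox_minimizer_exists[OF assms(1), of v] by (auto simp: is_arg_min_linorder)
  then have "is_arg_min (\<lambda>q. v \<bullet> (x - q) + D q x) (\<lambda>q. q \<in> X) p"
    unfolding p_def prox_def arg_min_on_def arg_min_def by (rule someI_ex)
  then show "p \<in> X" and "q \<in> X \<Longrightarrow> v \<bullet> (x - p) + D p x \<le> v \<bullet> (x - q) + D q x"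
    by (auto simp: is_arg_min_linorder)
qed

text \<open>The subgradient \<open>g x + v\<close> of \<open>h\<close> at \<open>p\<close> need not be the selected one \<open>g p\<close>; the selection is
  compared with it along the segment from \<open>p\<close> to \<open>q\<close>, where continuity of \<open>g\<close> gives the limit.\<close>

lemma prox_variational:
  fixes v :: 'a
  assumes x: "x \<in> X" and q: "q \<in> X"
  defines "p \<equiv> prox X h g x v"
  shows "(g p - g x - v) \<bullet> (q - p) \<ge> 0"
proof -
  have p: "p \<in> X" using prox_minimizes(1)[OF x] by (simp add: p_def)
  define r where "r s = p + s *\<^sub>R (q - p)" for s :: real
  have r_X: "r s \<in> X" if "s \<in> {0..1}" for s
  proof -
    have "r s = (1 - s) *\<^sub>R p + s *\<^sub>R q" by (simp add: r_def algebra_simps)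
    then show ?thesis using convex p q that by (simp add: convex_def)
  qed
  have nonneg: "(g (r s) - g x - v) \<bullet> (q - p) \<ge> 0" if "s \<in> {0<..1}" for s
  proof -
    have rs: "r s \<in> X" using r_X that by simp
    have "v \<bullet> (x - p) + D p x \<le> v \<bullet> (x - r s) + D (r s) x"
      using prox_minimizes(2)[OF x rs] by (simp add: p_def)
    \<comment> \<open>Convexity at the moving point \<open>r s\<close> bounds
      \<open>h (r s) - h p\<close> by a term in \<open>g (r s)\<close>, which eliminates the values
      of \<open>h\<close>.\<close>
    moreover have "real_of_ereal (h p) \<ge> real_of_ereal (h (r s)) + g (r s) \<bullet> (p - r s)"
      by (rule subgradient_ineq[OF rs p])
    ultimately have "0 \<le> (g (r s) - g x - v) \<bullet> (r s - p)"
      by (simp add: bregman_div_def inner_diff_left inner_diff_right)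
    also have "\<dots> = s * ((g (r s) - g x - v) \<bullet> (q - p))" by (simp add: r_def)
    finally show ?thesis using that by (simp add: zero_le_mult_iff)
  qed
  have "continuous_on {0..1} (\<lambda>s. (g (r s) - g x - v) \<bullet> (q - p))"
  proof (intro continuous_intros)
    have "continuous_on X g" using bregman by (simp add: bregman_finsler_def)
    then show "continuous_on {0..1} (\<lambda>s. g (r s))"
      by (rule continuous_on_compose2) (auto simp: r_X, auto simp: r_def intro!: continuous_intros)
  qed
  then have "((\<lambda>s. (g (r s) - g x - v) \<bullet> (q - p)) \<longlongrightarrow> (g (r 0) - g x - v) \<bullet> (q - p)) (at 0 within {0..1})"
    by (simp add: continuous_on)
  then have "((\<lambda>s. (g (r s) - g x - v) \<bullet> (q - p)) \<longlongrightarrow> (g (r 0) - g x - v) \<bullet> (q - p)) (at_right 0)"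
    by (simp add: at_within_Icc_at_right)
  moreover have "eventually (\<lambda>s. (g (r s) - g x - v) \<bullet> (q - p) \<ge> 0) (at_right 0)"
    using eventually_at_right_less[of "0::real"] eventually_at_right[of 0 "1::real"]
    by (metis (mono_tags, lifting) greaterThanAtMost_iff less_eq_real_def nonneg zero_less_one)
  ultimately have "(g (r 0) - g x - v) \<bullet> (q - p) \<ge> 0"
    by (intro tendsto_lowerbound) auto
  then show ?thesis by (simp add: r_def)
qed

text \<open>The three-point identity turns the variational inequality at \<open>p\<close> into a
  comparison of divergences; with \<open>q = x\<close> it also bounds the length of a step.\<close>

lemma prox_descent:
  fixes v :: 'a
  assumes "x \<in> X" "q \<in> X"
  defines "p \<equiv> prox X h g x v"
  shows "D q p \<le> D q x - D p x + v \<bullet> (p - q)"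
  using prox_variational[OF assms(1,2), of v] three_point[of q x p]
  unfolding p_def by (simp add: inner_diff_left inner_diff_right)

end

section \<open>Energy estimates along the algorithm\<close>

locale adaprox_run = bregman_geometry X F h g K
  for X :: "'a::euclidean_space set" and F h g K +
  fixes V :: "'a \<Rightarrow> 'a" and X1 :: 'a and x y :: "nat \<Rightarrow> 'a" and \<gamma> \<delta> :: "nat \<Rightarrow> real"
  assumes monotone: "monotone_operator X V"
    and X1: "X1 \<in> X"
    and algorithm: "adaprox X F h g V X1 x y \<gamma> \<delta>"
begin

lemma y_eq: "t \<ge> 1 \<Longrightarrow> y t = prox X h g (x t) (- (\<gamma> t *\<^sub>R V (x t)))"
  and x_Suc: "t \<ge> 1 \<Longrightarrow> x (t + 1) = prox X h g (x t) (- (\<gamma> t *\<^sub>R V (y t)))"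
  and \<delta>_eq: "t \<ge> 1 \<Longrightarrow> \<delta> t = dual_norm F (y t) (V (y t) - V (x t))"
  using algorithm by (auto simp: adaprox_def)

text \<open>The index is shifted so that one formula covers \<open>t = 1\<close>, where the sum is
  empty; \<open>\<gamma> t\<close> sees only the \<open>\<delta> s\<close> with
  \<open>s < t\<close>.\<close>

lemma \<gamma>_eq:
  assumes "t \<ge> 1"
  shows "\<gamma> t = 1 / sqrt (1 + (\<Sum>s=1..<t. (\<delta> s)\<^sup>2))"
proof (cases "t = 1")
  case True
  then show ?thesis using algorithm by (simp add: adaprox_def)
next
  case False
  define s where "s = t - 1"
  have s: "s \<ge> 1" "t = s + 1" using False assms by (auto simp: s_def)
  then have "\<gamma> (s + 1) = 1 / sqrt (1 + (\<Sum>r=1..s. (\<delta> r)\<^sup>2))"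
    using algorithm unfolding adaprox_def by blast
  moreover have "{1..s} = {1..<t}" using s by auto
  ultimately show ?thesis using s by simp
qed

lemma \<gamma>_pos: "t \<ge> 1 \<Longrightarrow> \<gamma> t > 0"
  by (simp add: \<gamma>_eq add_pos_nonneg sum_nonneg)

lemma \<gamma>_sq: "t \<ge> 1 \<Longrightarrow> (\<gamma> t)\<^sup>2 = 1 / (1 + (\<Sum>s=1..<t. (\<delta> s)\<^sup>2))"
  by (simp add: \<gamma>_eq power_divide add_nonneg_nonneg sum_nonneg)

lemma \<gamma>_le_1: "t \<ge> 1 \<Longrightarrow> \<gamma> t \<le> 1"
  by (simp add: \<gamma>_eq add_pos_nonneg sum_nonneg)

lemma x_in: "t \<ge> 1 \<Longrightarrow> x t \<in> X"
proof (induction t rule: nat_induct_at_least)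
  case base
  then show ?case using algorithm X1 by (simp add: adaprox_def)
next
  case (Suc t)
  then show ?case using x_Suc[of t] prox_minimizes(1) by simp
qed

lemma y_in: "t \<ge> 1 \<Longrightarrow> y t \<in> X"
  using y_eq x_in prox_minimizes(1) by simp

lemma energy_inequality:
  assumes t: "t \<ge> 1" and q: "q \<in> X"
  shows "\<gamma> t * (V (y t) \<bullet> (y t - q)) \<le>
    D q (x t) - D q (x (Suc t)) + (\<gamma> t * \<delta> t)\<^sup>2 / (2 * K) - D (y t) (x t)"
proof -
  have xS: "x (Suc t) \<in> X" using x_in[of "Suc t"] by simp
  define n where "n = F (y t) (y t - x (Suc t))"
  have 1: "D q (x (Suc t)) \<le> D q (x t) - D (x (Suc t)) (x t) - \<gamma> t * (V (y t) \<bullet> (x (Suc t) - q))"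
    using prox_descent[OF x_in[OF t] q, of "- (\<gamma> t *\<^sub>R V (y t))"] x_Suc[OF t] by simp
  \<comment> \<open>The leading step is tested with the next iterate, so that
    \<open>D (x (Suc t)) (x t)\<close> cancels against the previous inequality.\<close>
  have 2: "D (x (Suc t)) (y t) \<le> D (x (Suc t)) (x t) - D (y t) (x t) - \<gamma> t * (V (x t) \<bullet> (y t - x (Suc t)))"
    using prox_descent[OF x_in[OF t] xS, of "- (\<gamma> t *\<^sub>R V (x t))"] y_eq[OF t] by simp
  have 3: "\<gamma> t * ((V (y t) - V (x t)) \<bullet> (y t - x (Suc t))) \<le> \<gamma> t * (\<delta> t * n)"
    using inner_le[OF y_in[OF t] y_in[OF t]] \<gamma>_pos[OF t] \<delta>_eq[OF t]
    by (intro mult_left_mono) (simp_all add: n_def)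
  \<comment> \<open>Strong convexity is centered at \<open>y t\<close>, the point whose dual norm
    measures \<open>\<delta> t\<close>.\<close>
  have 4: "K / 2 * n\<^sup>2 \<le> D (x (Suc t)) (y t)"
    using D_lower_bound[OF y_in[OF t] xS] norm_minus_commute[OF y_in[OF t] y_in[OF t]]
    by (simp add: n_def)
  have "0 \<le> (\<gamma> t * \<delta> t - K * n)\<^sup>2 / (2 * K)" using K_pos by simp
  also have "\<dots> = (\<gamma> t * \<delta> t)\<^sup>2 / (2 * K) + K / 2 * n\<^sup>2 - \<gamma> t * (\<delta> t * n)"
    using K_pos by (simp add: power2_eq_square field_simps)
  finally have 5: "\<gamma> t * (\<delta> t * n) \<le> (\<gamma> t * \<delta> t)\<^sup>2 / (2 * K) + K / 2 * n\<^sup>2" by simp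
  have "\<gamma> t * (V (y t) \<bullet> (y t - q)) = \<gamma> t * (V (y t) \<bullet> (x (Suc t) - q))
      + \<gamma> t * (V (x t) \<bullet> (y t - x (Suc t))) + \<gamma> t * ((V (y t) - V (x t)) \<bullet> (y t - x (Suc t)))"
    by (simp add: algebra_simps inner_diff_left inner_diff_right)
  with 1 2 3 4 5 show ?thesis by linarith
qed

lemma summed_energy_inequality:
  assumes q: "q \<in> X"
  shows "(\<Sum>t=1..T. \<gamma> t * (V (y t) \<bullet> (y t - q))) \<le>
    D q X1 + (\<Sum>t=1..T. (\<gamma> t * \<delta> t)\<^sup>2) / (2 * K) - (\<Sum>t=1..T. D (y t) (x t))"
proof -
  \<comment> \<open>The final divergence is kept during the induction so that the sum telescopes;
    nonnegativity removes it afterwards.\<close>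
  have "(\<Sum>t=1..T. \<gamma> t * (V (y t) \<bullet> (y t - q))) \<le>
    D q X1 - D q (x (Suc T)) + (\<Sum>t=1..T. (\<gamma> t * \<delta> t)\<^sup>2) / (2 * K) - (\<Sum>t=1..T. D (y t) (x t))"
  proof (induction T)
    case 0
    then show ?case using algorithm by (simp add: adaprox_def)
  next
    case (Suc T)
    then show ?case
      using energy_inequality[OF _ q, of "Suc T"] by (simp add: add_divide_distrib)
  qed
  moreover have "D q (x (Suc T)) \<ge> 0" using D_nonneg x_in q by simp
  ultimately show ?thesis by linarith
qed

lemma sum_\<gamma>_pos: "T \<ge> 1 \<Longrightarrow> (\<Sum>t=1..T. \<gamma> t) > 0"
  by (intro sum_pos) (auto simp: \<gamma>_pos)

lemma inner_ergodic_average: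
  assumes "T \<ge> 1"
  shows "v \<bullet> (ergodic_average \<gamma> y T - q) = (\<Sum>t=1..T. \<gamma> t * (v \<bullet> (y t - q))) / (\<Sum>t=1..T. \<gamma> t)"
proof -
  have "(\<Sum>t=1..T. \<gamma> t * (v \<bullet> (y t - q))) = v \<bullet> (\<Sum>t=1..T. \<gamma> t *\<^sub>R y t) - (\<Sum>t=1..T. \<gamma> t) * (v \<bullet> q)"
    by (simp add: inner_sum_right inner_diff_right right_diff_distrib sum_subtractf sum_distrib_right)
  then show ?thesis
    using sum_\<gamma>_pos[OF assms] by (simp add: ergodic_average_def inner_diff_right field_simps)
qed

text \<open>Monotonicity replaces \<open>V q\<close> by \<open>V (y t)\<close> in the upper bound.
  The lower bound, from testing with the solution, is needed because O-notation controls the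
  absolute value.\<close>

lemma gap_bounds:
  assumes C: "C \<subseteq> X" and sol: "vi_solution V X xsol" "xsol \<in> C"
    and H: "\<And>q. q \<in> C \<Longrightarrow> D q X1 \<le> H"
    and B: "(\<Sum>t=1..T. (\<gamma> t * \<delta> t)\<^sup>2) \<le> B" and T: "T \<ge> 1"
  shows "0 \<le> Gap V C (ergodic_average \<gamma> y T)"
    and "Gap V C (ergodic_average \<gamma> y T) \<le> (H + B / (2 * K)) / (\<Sum>t=1..T. \<gamma> t)"
proof -
  have le: "V q \<bullet> (ergodic_average \<gamma> y T - q) \<le> (H + B / (2 * K)) / (\<Sum>t=1..T. \<gamma> t)"
    if q: "q \<in> C" for q
  proof -
    have qX: "q \<in> X" using q C by blast
    have "(\<Sum>t=1..T. \<gamma> t * (V q \<bullet> (y t - q))) \<le> (\<Sum>t=1..T. \<gamma> t * (V (y t) \<bullet> (y t - q)))"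
    proof (intro sum_mono mult_left_mono)
      fix t assume t: "t \<in> {1..T}"
      then have "(V (y t) - V q) \<bullet> (y t - q) \<ge> 0"
        using monotone y_in qX by (simp add: monotone_operator_def)
      then show "V q \<bullet> (y t - q) \<le> V (y t) \<bullet> (y t - q)" by (simp add: inner_diff_left)
      show "\<gamma> t \<ge> 0" using \<gamma>_pos[of t] t by simp
    qed
    also have "\<dots> \<le> D q X1 + (\<Sum>t=1..T. (\<gamma> t * \<delta> t)\<^sup>2) / (2 * K) - (\<Sum>t=1..T. D (y t) (x t))"
      by (rule summed_energy_inequality[OF qX])
    also have "\<dots> \<le> H + B / (2 * K)"
    proof -
      have "(\<Sum>t=1..T. D (y t) (x t)) \<ge> 0" by (intro sum_nonneg D_nonneg) (auto intro: x_in y_in)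
      moreover have "(\<Sum>t=1..T. (\<gamma> t * \<delta> t)\<^sup>2) / (2 * K) \<le> B / (2 * K)"
        using B K_pos by (simp add: divide_right_mono)
      ultimately show ?thesis using H[OF q] by linarith
    qed
    finally show ?thesis
      using sum_\<gamma>_pos[OF T] by (simp add: inner_ergodic_average[OF T] divide_right_mono)
  qed
  show "Gap V C (ergodic_average \<gamma> y T) \<le> (H + B / (2 * K)) / (\<Sum>t=1..T. \<gamma> t)"
    unfolding Gap_def using sol(2) le by (intro cSUP_least) auto
  have "0 \<le> V xsol \<bullet> (ergodic_average \<gamma> y T - xsol)"
    unfolding inner_ergodic_average[OF T]
  proof (intro divide_nonneg_nonneg sum_nonneg mult_nonneg_nonneg)
    fix t assume t: "t \<in> {1..T}"
    show "\<gamma> t \<ge> 0" and "\<gamma> t \<ge> 0" using \<gamma>_pos[of t] t by auto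
    show "V xsol \<bullet> (y t - xsol) \<ge> 0" using sol(1) y_in t by (simp add: vi_solution_def)
  qed
  \<comment> \<open>The bound \<open>le\<close>, uniform over \<open>C\<close>, also shows that the
    supremum defining \<open>Gap\<close> is finite.\<close>
  also have "\<dots> \<le> Gap V C (ergodic_average \<gamma> y T)"
    unfolding Gap_def using sol(2) le by (intro cSUP_upper bdd_aboveI2) auto
  finally show "0 \<le> Gap V C (ergodic_average \<gamma> y T)" .
qed

text \<open>A constant \<open>S\<close> gives linear growth of the summed step sizes;
  \<open>S\<close> proportional to \<open>T\<close> gives growth of order
  \<open>sqrt T\<close>.\<close>

lemma sum_\<gamma>_ge:
  assumes T: "T \<ge> 1" and S: "(\<Sum>t=1..T. (\<delta> t)\<^sup>2) \<le> S"
  shows "(\<Sum>t=1..T. \<gamma> t) \<ge> T / sqrt (1 + S)"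
proof -
  have "1 / sqrt (1 + S) \<le> \<gamma> t" if t: "t \<in> {1..T}" for t
  proof -
    have "(\<Sum>s=1..<t. (\<delta> s)\<^sup>2) \<le> (\<Sum>s=1..T. (\<delta> s)\<^sup>2)"
      using t by (intro sum_mono2) auto
    then have "sqrt (1 + (\<Sum>s=1..<t. (\<delta> s)\<^sup>2)) \<le> sqrt (1 + S)" using S by simp
    moreover have "0 < sqrt (1 + (\<Sum>s=1..<t. (\<delta> s)\<^sup>2))" by (simp add: add_pos_nonneg sum_nonneg)
    ultimately show ?thesis using t by (simp add: \<gamma>_eq frac_le)
  qed
  then have "(\<Sum>t=1..T. 1 / sqrt (1 + S)) \<le> (\<Sum>t=1..T. \<gamma> t)" by (intro sum_mono)
  then show ?thesis by simp
qed

section \<open>Metrically smooth operators\<close>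

text \<open>Smoothness pairs the dual norm at \<open>y t\<close> with the primal norm at
  \<open>x t\<close>, and the latter is the norm in which strong convexity bounds
  \<open>D (y t) (x t)\<close>.\<close>

lemma \<delta>_sq_le_D:
  assumes L: "L > 0" and smooth: "metrically_smooth X F V L" and t: "t \<ge> 1"
  shows "K / (2 * L\<^sup>2) * (\<delta> t)\<^sup>2 \<le> D (y t) (x t)"
proof -
  note yt = y_in[OF t] and xt = x_in[OF t]
  have "\<delta> t = dual_norm F (y t) (V (x t) - V (y t))"
    using \<delta>_eq[OF t] dual_minus_commute[OF yt yt] by simp
  also have "\<dots> \<le> L * F (x t) (x t - y t)"
    using smooth xt yt by (simp add: metrically_smooth_def)
  also have "F (x t) (x t - y t) = F (x t) (y t - x t)"
    by (rule norm_minus_commute[OF xt xt])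
  finally have "\<delta> t \<le> L * F (x t) (y t - x t)" .
  moreover have "\<delta> t \<ge> 0" using \<delta>_eq[OF t] dual_nonneg[OF yt yt] by simp
  ultimately have "(\<delta> t)\<^sup>2 \<le> (L * F (x t) (y t - x t))\<^sup>2" by (rule power_mono)
  then have "K / (2 * L\<^sup>2) * (\<delta> t)\<^sup>2 \<le> K / (2 * L\<^sup>2) * (L * F (x t) (y t - x t))\<^sup>2"
    using K_pos by (intro mult_left_mono) auto
  also have "\<dots> = K / 2 * (F (x t) (y t - x t))\<^sup>2"
    using L by (simp add: power_mult_distrib)
  also have "\<dots> \<le> D (y t) (x t)" by (rule D_lower_bound[OF xt yt])
  finally show ?thesis .
qed

text \<open>If the sum diverged, the step sizes would tend to zero, and eventually the error terms
  \<open>(\<gamma> t * \<delta> t)\<^sup>2 / (2 * K)\<close> would be absorbed by half of the divergences \<open>D (y t) (x t)\<close>.\<close>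

lemma sum_\<delta>_sq_bounded:
  assumes L: "L > 0" and smooth: "metrically_smooth X F V L" and sol: "vi_solution V X xsol"
  obtains S where "S \<ge> 0" "\<And>T. (\<Sum>t=1..T. (\<delta> t)\<^sup>2) \<le> S"
proof -
  define a where "a = K / (2 * L\<^sup>2)"
  have a: "a > 0" using K_pos L by (simp add: a_def)
  have xsol: "xsol \<in> X" using sol by (simp add: vi_solution_def)
  have main: "a * (\<Sum>t=1..T. (\<delta> t)\<^sup>2) \<le> D xsol X1 + (\<Sum>t=1..T. (\<gamma> t * \<delta> t)\<^sup>2) / (2 * K)" for T
  proof -
    have "0 \<le> (\<Sum>t=1..T. \<gamma> t * (V (y t) \<bullet> (y t - xsol)))"
    proof (intro sum_nonneg mult_nonneg_nonneg)
      fix t assume t: "t \<in> {1..T}"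
      show "\<gamma> t \<ge> 0" using \<gamma>_pos[of t] t by simp
      have "(V (y t) - V xsol) \<bullet> (y t - xsol) \<ge> 0" "V xsol \<bullet> (y t - xsol) \<ge> 0"
        using monotone sol xsol y_in t by (auto simp: monotone_operator_def vi_solution_def)
      then show "V (y t) \<bullet> (y t - xsol) \<ge> 0" by (simp add: inner_diff_left)
    qed
    moreover have "a * (\<Sum>t=1..T. (\<delta> t)\<^sup>2) \<le> (\<Sum>t=1..T. D (y t) (x t))"
      unfolding sum_distrib_left a_def using \<delta>_sq_le_D[OF L smooth] by (intro sum_mono) auto
    ultimately show ?thesis using summed_energy_inequality[OF xsol, of T] by linarith
  qed
  have "\<exists>S. \<forall>T. (\<Sum>t=1..T. (\<delta> t)\<^sup>2) \<le> S"
  proof (rule ccontr)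
    assume unbounded: "\<nexists>S. \<forall>T. (\<Sum>t=1..T. (\<delta> t)\<^sup>2) \<le> S"
    \<comment> \<open>The threshold makes \<open>(\<gamma> t)\<^sup>2\<close> at most
      \<open>K * a\<close> beyond \<open>T0\<close>, so an error term there costs at most
      \<open>a / 2 * (\<delta> t)\<^sup>2\<close>.\<close>
    then obtain T0 where T0: "1 / (K * a) < (\<Sum>t=1..T0. (\<delta> t)\<^sup>2)" by (meson not_le)
    have small: "(\<gamma> t)\<^sup>2 / (2 * K) \<le> a / 2" if "t > T0" for t
    proof -
      have "(\<Sum>s=1..T0. (\<delta> s)\<^sup>2) \<le> (\<Sum>s=1..<t. (\<delta> s)\<^sup>2)"
        using that by (intro sum_mono2) auto
      with T0 have *: "1 / (K * a) \<le> 1 + (\<Sum>s=1..<t. (\<delta> s)\<^sup>2)" by linarith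
      have "(\<gamma> t)\<^sup>2 \<le> K * a"
      proof -
        have "1 / (1 + (\<Sum>s=1..<t. (\<delta> s)\<^sup>2)) \<le> 1 / (1 / (K * a))"
          using * a K_pos by (intro divide_left_mono) (auto simp: add_pos_nonneg sum_nonneg)
        then show ?thesis using \<gamma>_sq[of t] that by simp
      qed
      then show ?thesis using K_pos by (simp add: field_simps)
    qed
    define E where "E = (\<Sum>t=1..T0. (\<delta> t)\<^sup>2) / (2 * K)"
    \<comment> \<open>Terms up to \<open>T0\<close> are bounded using
      \<open>\<gamma> t \<le> 1\<close> and add up to at most the constant \<open>E\<close>; later
      ones are absorbed.\<close>
    have step: "(\<gamma> t * \<delta> t)\<^sup>2 / (2 * K) \<le> (if t \<le> T0 then (\<delta> t)\<^sup>2 / (2 * K) else 0) + a / 2 * (\<delta> t)\<^sup>2"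
      if t: "t \<ge> 1" for t
    proof (cases "t \<le> T0")
      case True
      have "(\<gamma> t)\<^sup>2 * (\<delta> t)\<^sup>2 \<le> 1 * (\<delta> t)\<^sup>2"
        using \<gamma>_le_1[OF t] \<gamma>_pos[OF t] by (intro mult_right_mono) (auto simp: power_le_one)
      then have "(\<gamma> t * \<delta> t)\<^sup>2 / (2 * K) \<le> (\<delta> t)\<^sup>2 / (2 * K)"
        using K_pos by (simp add: power_mult_distrib divide_right_mono)
      then show ?thesis using a True by (simp add: add_increasing2)
    next
      case False
      have "(\<gamma> t)\<^sup>2 / (2 * K) * (\<delta> t)\<^sup>2 \<le> a / 2 * (\<delta> t)\<^sup>2"
        using small[of t] False by (intro mult_right_mono) auto
      then show ?thesis using False by (simp add: power_mult_distrib)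
    qed
    have "(\<Sum>t=1..T. (\<delta> t)\<^sup>2) \<le> (D xsol X1 + E) / (a / 2)" for T
    proof -
      have "(\<Sum>t=1..T. (\<gamma> t * \<delta> t)\<^sup>2) / (2 * K) \<le>
          (\<Sum>t=1..T. (if t \<le> T0 then (\<delta> t)\<^sup>2 / (2 * K) else 0) + a / 2 * (\<delta> t)\<^sup>2)"
        unfolding sum_divide_distrib using step by (intro sum_mono) auto
      also have "\<dots> = (\<Sum>t\<in>{t\<in>{1..T}. t \<le> T0}. (\<delta> t)\<^sup>2 / (2 * K)) + a / 2 * (\<Sum>t=1..T. (\<delta> t)\<^sup>2)"
        by (simp only: sum.distrib sum_distrib_left sum.inter_filter[OF finite_atLeastAtMost])
      also have "(\<Sum>t\<in>{t\<in>{1..T}. t \<le> T0}. (\<delta> t)\<^sup>2 / (2 * K)) \<le> E"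
        unfolding E_def sum_divide_distrib using K_pos by (intro sum_mono2) auto
      finally have "a / 2 * (\<Sum>t=1..T. (\<delta> t)\<^sup>2) \<le> D xsol X1 + E"
        using main[of T] by linarith
      then show ?thesis using a by (simp add: field_simps)
    qed
    with unbounded show False by blast
  qed
  then obtain S where S: "\<And>T. (\<Sum>t=1..T. (\<delta> t)\<^sup>2) \<le> S" by blast
  from S[of 0] have "S \<ge> 0" by simp
  with S that show thesis by blast
qed

section \<open>Metrically bounded operators\<close>

text \<open>\<open>V (x t)\<close> is bounded in the dual norm at \<open>x t\<close>, but
  \<open>\<delta> t\<close> uses the one at \<open>y t\<close>. Regularity transfers the bound once
  the step length \<open>n\<close> is controlled.\<close>

lemma \<delta>_bounded:
  assumes M: "M > 0" and bounded: "metrically_bounded X F V M" and regular: "regular_metric X F"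
  obtains d where "d > 0" "\<And>t. t \<ge> 1 \<Longrightarrow> (\<delta> t)\<^sup>2 \<le> d"
proof -
  obtain \<beta> where \<beta>: "\<beta> > 0"
    "\<And>p p' v. p \<in> X \<Longrightarrow> p' \<in> X \<Longrightarrow> v \<noteq> 0 \<Longrightarrow>
      dual_norm F p' v / dual_norm F p v \<le> 1 + \<beta> * F p (p' - p)"
    using regular unfolding regular_metric_def by blast
  have "\<delta> t \<le> M + (1 + \<beta> * (2 * M / K)) * M" if t: "t \<ge> 1" for t
  proof -
    note yt = y_in[OF t] and xt = x_in[OF t]
    define n where "n = F (x t) (y t - x t)"
    have n: "n \<ge> 0" using local_norm[OF xt] by (simp add: n_def is_norm_def)
    have Vx: "dual_norm F (x t) (V (x t)) \<le> M" using bounded xt by (simp add: metrically_bounded_def)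
    \<comment> \<open>Testing the prox step with its own center bounds \<open>D (y t) (x t)\<close>
      linearly in \<open>n\<close>, while strong convexity bounds it below quadratically; hence
      \<open>n \<le> 2 * M / K\<close>.\<close>
    have "D (x t) (y t) \<le> D (x t) (x t) - D (y t) (x t) - \<gamma> t * (V (x t) \<bullet> (y t - x t))"
      using prox_descent[OF xt xt, of "- (\<gamma> t *\<^sub>R V (x t))"] y_eq[OF t] by simp
    then have "D (y t) (x t) \<le> \<gamma> t * (V (x t) \<bullet> (x t - y t))"
      using D_nonneg[OF yt xt] D_self by (simp add: inner_diff_right algebra_simps)
    also have "V (x t) \<bullet> (x t - y t) \<le> dual_norm F (x t) (V (x t)) * n"
      using inner_le[OF xt xt, of "V (x t)" "x t - y t"]
        norm_minus_commute[OF xt xt]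
      by (simp add: n_def)
    also have "\<dots> \<le> M * n" using Vx n by (rule mult_right_mono)
    also have "\<gamma> t * (M * n) \<le> 1 * (M * n)"
      using \<gamma>_le_1[OF t] M n by (intro mult_right_mono) auto
    finally have "D (y t) (x t) \<le> M * n" using \<gamma>_pos[OF t] by (simp add: mult_left_mono)
    then have "K / 2 * n\<^sup>2 \<le> M * n" using D_lower_bound[OF xt yt] by (simp add: n_def)
    then have n_le: "n \<le> 2 * M / K"
    proof (cases "n = 0")
      case True
      then show ?thesis using M K_pos by simp
    next
      case False
      then have "n > 0" using n by simp
      moreover have "(K / 2 * n) * n \<le> M * n" using \<open>K / 2 * n\<^sup>2 \<le> M * n\<close> by (simp add: power2_eq_square)
      ultimately have "K / 2 * n \<le> M" by (simp only: mult_le_cancel_right_pos)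
      then show ?thesis using K_pos by (simp add: field_simps)
    qed
    have "dual_norm F (y t) (V (x t)) \<le> (1 + \<beta> * (2 * M / K)) * M"
    \<comment> \<open>Regularity compares dual norms of nonzero vectors only.\<close>
    proof (cases "V (x t) = 0")
      case True
      then show ?thesis
        using dual_zero[OF yt yt] M K_pos \<beta>(1) by simp
    next
      case False
      have pos: "dual_norm F (x t) (V (x t)) > 0"
        using dual_pos[OF xt xt False] .
      have "dual_norm F (y t) (V (x t)) \<le> (1 + \<beta> * n) * dual_norm F (x t) (V (x t))"
        using \<beta>(2)[OF xt yt False] pos by (simp add: n_def field_simps)
      also have "\<dots> \<le> (1 + \<beta> * (2 * M / K)) * M"
        using Vx pos n n_le \<beta>(1) M K_pos by (intro mult_mono add_mono mult_left_mono) auto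
      finally show ?thesis .
    qed
    moreover have "dual_norm F (y t) (V (y t)) \<le> M" using bounded yt by (simp add: metrically_bounded_def)
    moreover have "\<delta> t \<le> dual_norm F (y t) (V (y t)) + dual_norm F (y t) (V (x t))"
      unfolding \<delta>_eq[OF t] by (rule dual_diff_le[OF yt yt])
    ultimately show ?thesis by linarith
  qed
  moreover have "\<delta> t \<ge> 0" if "t \<ge> 1" for t
    using \<delta>_eq[OF that] dual_nonneg[OF y_in[OF that] y_in[OF that]] by simp
  ultimately have "(\<delta> t)\<^sup>2 \<le> (M + (1 + \<beta> * (2 * M / K)) * M)\<^sup>2" if "t \<ge> 1" for t
    using that by (intro power_mono) auto
  moreover have "M + (1 + \<beta> * (2 * M / K)) * M > 0"
    using M \<beta>(1) K_pos by (simp add: add_pos_pos)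
  ultimately show thesis using that by (metis zero_less_power)
qed

text \<open>The denominator in \<open>(\<gamma> t)\<^sup>2\<close> lags one term behind the sum; the
  factor \<open>1 + d\<close> pays for adding that term. The resulting quotients are bounded by
  telescoping differences of logarithms.\<close>

lemma sum_\<gamma>\<delta>_sq_le_ln:
  assumes d: "d > 0" "\<And>t. t \<ge> 1 \<Longrightarrow> (\<delta> t)\<^sup>2 \<le> d"
  shows "(\<Sum>t=1..T. (\<gamma> t * \<delta> t)\<^sup>2) \<le> (1 + d) * ln (1 + (\<Sum>t=1..T. (\<delta> t)\<^sup>2))"
proof (induction T)
  case 0
  then show ?case by simp
next
  case (Suc T)
  define S where "S = (\<Sum>t=1..T. (\<delta> t)\<^sup>2)"
  define e where "e = (\<delta> (Suc T))\<^sup>2"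
  have S: "S \<ge> 0" and e: "e \<ge> 0" "e \<le> d" using d(2) by (auto simp: S_def e_def sum_nonneg)
  have "(\<gamma> (Suc T))\<^sup>2 = 1 / (1 + S)"
    using \<gamma>_sq[of "Suc T"] by (simp add: S_def atLeastLessThanSuc_atLeastAtMost)
  then have "(\<gamma> (Suc T) * \<delta> (Suc T))\<^sup>2 = e / (1 + S)" by (simp add: power_mult_distrib e_def)
  also have "\<dots> \<le> (1 + d) * (e / (1 + S + e))"
  proof -
    have "1 + S + e \<le> (1 + d) * (1 + S)" using S e d(1) by (simp add: algebra_simps add_increasing2)
    then have "e * (1 + S + e) \<le> e * ((1 + d) * (1 + S))" using e by (intro mult_left_mono)
    then show ?thesis using S e by (simp add: field_simps)
  qed
  also have "e / (1 + S + e) \<le> ln (1 + S + e) - ln (1 + S)"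
  proof -
    have "ln ((1 + S) / (1 + S + e)) \<le> (1 + S) / (1 + S + e) - 1"
      using S e by (intro ln_le_minus_one) (simp add: add_pos_nonneg)
    moreover have "ln ((1 + S) / (1 + S + e)) = ln (1 + S) - ln (1 + S + e)"
      using S e by (intro ln_divide_pos) auto
    moreover have "(1 + S) / (1 + S + e) - 1 = - (e / (1 + S + e))"
      using S e by (simp add: field_simps)
    ultimately show ?thesis by linarith
  qed
  finally have "(\<gamma> (Suc T) * \<delta> (Suc T))\<^sup>2 \<le> (1 + d) * (ln (1 + S + e) - ln (1 + S))"
    using d(1) by simp
  moreover have "(\<Sum>t=1..Suc T. (\<delta> t)\<^sup>2) = S + e" by (simp add: S_def e_def)
  moreover have "(\<Sum>t=1..T. (\<gamma> t * \<delta> t)\<^sup>2) \<le> (1 + d) * ln (1 + S)"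
    using Suc.IH by (simp only: S_def)
  ultimately show ?case by (simp add: right_diff_distrib add.assoc)
qed


section \<open>Finiteness of the radius and asymptotic rates\<close>

lemma D_bdd_above:
  assumes "C \<subseteq> X" "compact C"
  shows "bdd_above ((\<lambda>p. D p X1) ` C)"
proof -
  have "continuous_on C g"
    using bregman assms(1) continuous_on_subset unfolding bregman_finsler_def by blast
  then have "continuous_on C (\<lambda>p. (g p - g X1) \<bullet> (p - X1))" by (intro continuous_intros)
  then have "bdd_above ((\<lambda>p. (g p - g X1) \<bullet> (p - X1)) ` C)"
    using assms(2) by (intro bounded_imp_bdd_above compact_imp_bounded compact_continuous_image)
  then obtain B where B: "\<And>p. p \<in> C \<Longrightarrow> (g p - g X1) \<bullet> (p - X1) \<le> B"
    by (auto simp: bdd_above_def)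
  \<comment> \<open>The subgradient inequality at \<open>p\<close> bounds \<open>D p X1\<close> by
    an expression in the continuous selection \<open>g\<close>, so no continuity of \<open>h\<close>
    on \<open>C\<close> is invoked.\<close>
  have "D p X1 \<le> B" if "p \<in> C" for p
  proof -
    have "real_of_ereal (h X1) \<ge> real_of_ereal (h p) + g p \<bullet> (X1 - p)"
      using subgradient_ineq[of p X1] that assms(1) X1 by blast
    then have "D p X1 \<le> (g p - g X1) \<bullet> (p - X1)"
      by (simp add: bregman_div_def inner_diff_left inner_diff_right)
    with B[OF that] show ?thesis by linarith
  qed
  then show ?thesis by (rule bdd_aboveI2)
qed

text \<open>\<open>A\<close> and \<open>c\<close> stand for the explicit constants of the rate.
  Passing from \<open>ln (1 + d * T)\<close> to \<open>ln (1 + c * T)\<close> costs an additive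
  constant, which the positive \<open>A\<close> absorbs.\<close>

lemma gap_bigo_bounded:
  assumes C: "C \<subseteq> X" and sol: "vi_solution V X xsol" "xsol \<in> C"
    and H: "\<And>q. q \<in> C \<Longrightarrow> D q X1 \<le> H"
    and M: "M > 0" and bounded: "metrically_bounded X F V M" and regular: "regular_metric X F"
    and A: "A > 0" and c: "c > 0"
  shows "(\<lambda>T. Gap V C (ergodic_average \<gamma> y T)) \<in> O(\<lambda>T. (H + A + ln (1 + c * real T)) / sqrt (real T))"
proof -
  obtain d where d: "d > 0" "\<And>t. t \<ge> 1 \<Longrightarrow> (\<delta> t)\<^sup>2 \<le> d"
    using \<delta>_bounded[OF M bounded regular] by blast
  define Q where "Q = (1 + d) / (2 * K)"
  define r where "r = Q * ln (1 + d / c)"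
  have Q: "Q > 0" using d(1) K_pos by (simp add: Q_def)
  have r: "r \<ge> 0" using Q d(1) c by (simp add: r_def)
  have H0: "H \<ge> 0" using H[OF sol(2)] D_nonneg[of X1 xsol] X1 sol C by fastforce
  have "norm (Gap V C (ergodic_average \<gamma> y T)) \<le>
      (sqrt (1 + d) * (1 + Q + r / A)) * norm ((H + A + ln (1 + c * real T)) / sqrt (real T))"
    if T: "T \<ge> 1" for T
  proof -
    have sumd: "(\<Sum>t=1..T. (\<delta> t)\<^sup>2) \<le> d * T"
      using sum_bounded_above[of "{1..T}" "\<lambda>t. (\<delta> t)\<^sup>2" d] d(2) by (simp add: mult.commute)
    have B: "(\<Sum>t=1..T. (\<gamma> t * \<delta> t)\<^sup>2) \<le> (1 + d) * ln (1 + d * T)"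
    proof -
      have "ln (1 + (\<Sum>t=1..T. (\<delta> t)\<^sup>2)) \<le> ln (1 + d * T)"
        using sumd by (intro ln_mono) (auto simp: add_pos_nonneg sum_nonneg)
      then show ?thesis
        using sum_\<gamma>\<delta>_sq_le_ln[OF d] d(1) by (smt (verit) mult_left_mono)
    qed
    have ln_le: "ln (1 + d * T) \<le> ln (1 + d / c) + ln (1 + c * T)"
    proof -
      have "1 + d * T \<le> (1 + d / c) * (1 + c * T)"
        using d(1) c by (simp add: field_simps)
      then have "ln (1 + d * T) \<le> ln ((1 + d / c) * (1 + c * T))"
        using d(1) by (intro ln_mono) (auto simp: add_pos_nonneg)
      also have "\<dots> = ln (1 + d / c) + ln (1 + c * T)"
        using d(1) c by (intro ln_mult_pos) (auto simp: add_pos_nonneg)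
      finally show ?thesis .
    qed
    have ln0: "ln (1 + c * T) \<ge> 0" using c by simp
    have "(1 + d) * ln (1 + d * T) / (2 * K) = Q * ln (1 + d * T)" by (simp add: Q_def)
    also have "\<dots> \<le> r + Q * ln (1 + c * T)"
      using mult_left_mono[OF ln_le, of Q] Q by (simp add: r_def distrib_left)
    finally have "H + (1 + d) * ln (1 + d * T) / (2 * K) \<le> H + r / A * A + Q * ln (1 + c * T)"
      using A by simp
    also have "\<dots> \<le> (1 + Q + r / A) * (H + A + ln (1 + c * T))"
    proof -
      have "0 \<le> (Q + r / A) * H + (1 + Q) * A + (1 + r / A) * ln (1 + c * T)"
        using Q r A H0 ln0 by simp
      then show ?thesis by (simp add: algebra_simps)
    qed
    finally have num: "H + (1 + d) * ln (1 + d * T) / (2 * K) \<le> (1 + Q + r / A) * (H + A + ln (1 + c * T))" .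
    \<comment> \<open>For \<open>T \<ge> 1\<close>, \<open>1 + d * T\<close> is at most
      \<open>(1 + d) * T\<close>, which leaves a clean multiple of \<open>sqrt T\<close>.\<close>
    have den: "sqrt T / sqrt (1 + d) \<le> (\<Sum>t=1..T. \<gamma> t)"
    proof -
      have "1 + d * T \<le> (1 + d) * T" using T by (simp add: algebra_simps)
      then have "sqrt (1 + d * T) \<le> sqrt (1 + d) * sqrt T" by (simp flip: real_sqrt_mult)
      then have "T / (sqrt (1 + d) * sqrt T) \<le> T / sqrt (1 + d * T)"
        using d(1) T by (intro divide_left_mono mult_pos_pos) (auto simp: add_pos_nonneg)
      moreover have "T / (sqrt (1 + d) * sqrt T) = sqrt T / sqrt (1 + d)"
        by (metis real_div_sqrt of_nat_0_le_iff divide_divide_eq_left mult.commute)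
      ultimately show ?thesis using sum_\<gamma>_ge[OF T sumd] by linarith
    qed
    have "Gap V C (ergodic_average \<gamma> y T) \<le> (H + (1 + d) * ln (1 + d * T) / (2 * K)) / (\<Sum>t=1..T. \<gamma> t)"
      by (rule gap_bounds(2)[OF C sol H B T])
    also have "\<dots> \<le> ((1 + Q + r / A) * (H + A + ln (1 + c * T))) / (sqrt T / sqrt (1 + d))"
      using num den d(1) T Q r A H0 ln0 by (intro frac_le) auto
    also have "\<dots> = (sqrt (1 + d) * (1 + Q + r / A)) * ((H + A + ln (1 + c * T)) / sqrt T)"
      by simp
    also have "(H + A + ln (1 + c * T)) / sqrt T = norm ((H + A + ln (1 + c * T)) / sqrt T)"
      using H0 A ln0 by simp
    finally show ?thesis using gap_bounds(1)[OF C sol H B T] by simp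
  qed
  then show ?thesis
    by (intro bigoI) (rule eventually_mono[OF eventually_ge_at_top[of 1]])
qed

text \<open>Positivity of \<open>H\<close> lets the additive \<open>S / (2 * K)\<close> be absorbed
  into a constant multiple of \<open>H\<close>.\<close>

lemma gap_bigo_smooth:
  assumes C: "C \<subseteq> X" and sol: "vi_solution V X xsol" "xsol \<in> C"
    and H: "\<And>q. q \<in> C \<Longrightarrow> D q X1 \<le> H" and "H > 0"
    and L: "L > 0" and smooth: "metrically_smooth X F V L"
  shows "(\<lambda>T. Gap V C (ergodic_average \<gamma> y T)) \<in> O(\<lambda>T. H / real T)"
proof -
  obtain S where S: "S \<ge> 0" "\<And>T. (\<Sum>t=1..T. (\<delta> t)\<^sup>2) \<le> S"
    using sum_\<delta>_sq_bounded[OF L smooth sol(1)] by blast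
  have "norm (Gap V C (ergodic_average \<gamma> y T)) \<le>
      (sqrt (1 + S) * (H + S / (2 * K)) / H) * norm (H / real T)" if T: "T \<ge> 1" for T
  proof -
    have B: "(\<Sum>t=1..T. (\<gamma> t * \<delta> t)\<^sup>2) \<le> S"
    proof -
      have "(\<gamma> t)\<^sup>2 * (\<delta> t)\<^sup>2 \<le> 1 * (\<delta> t)\<^sup>2" if "t \<in> {1..T}" for t
        using \<gamma>_le_1[of t] \<gamma>_pos[of t] that by (intro mult_right_mono) (auto simp: power_le_one)
      then have "(\<Sum>t=1..T. (\<gamma> t * \<delta> t)\<^sup>2) \<le> (\<Sum>t=1..T. (\<delta> t)\<^sup>2)"
        by (intro sum_mono) (simp add: power_mult_distrib)
      then show ?thesis using S(2) by (rule order_trans)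
    qed
    have "Gap V C (ergodic_average \<gamma> y T) \<le> (H + S / (2 * K)) / (\<Sum>t=1..T. \<gamma> t)"
      by (rule gap_bounds(2)[OF C sol H B T])
    also have "\<dots> \<le> (H + S / (2 * K)) / (T / sqrt (1 + S))"
      using sum_\<gamma>_ge[OF T S(2)] S(1) T K_pos \<open>H > 0\<close> by (intro divide_left_mono mult_pos_pos sum_\<gamma>_pos) auto
    also have "\<dots> = (sqrt (1 + S) * (H + S / (2 * K)) / H) * norm (H / real T)"
      using \<open>H > 0\<close> by simp
    finally show ?thesis using gap_bounds(1)[OF C sol H B T] by simp
  qed
  then show ?thesis
    by (intro bigoI) (rule eventually_mono[OF eventually_ge_at_top[of 1]])
qed

text \<open>Strong convexity collapses \<open>C\<close> to \<open>X1\<close>. As \<open>C\<close> is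
  a neighborhood, this point is open and closed in the connected set \<open>X\<close>, hence all of
  \<open>X\<close>.\<close>

lemma singleton_if_radius_zero:
  assumes C: "C \<subseteq> X" and U: "openin (top_of_set X) U" "xsol \<in> U" "U \<subseteq> C"
    and H: "\<And>q. q \<in> C \<Longrightarrow> D q X1 \<le> 0"
  shows "X = {X1}" "C = {X1}"
proof -
  have "q = X1" if q: "q \<in> C" for q
  proof -
    have "K / 2 * (F X1 (q - X1))\<^sup>2 \<le> 0"
      using D_lower_bound[OF X1, of q] H[OF q] C q by force
    then have "F X1 (q - X1) = 0" using K_pos by (simp add: mult_le_0_iff)
    then show ?thesis using local_norm[OF X1] by (simp add: is_norm_def)
  qed
  then have "C \<subseteq> {X1}" by blast
  then show "C = {X1}" using U by blast
  then have "U = {X1}" using U by blast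
  then have "openin (top_of_set X) {X1}" using U(1) by simp
  moreover have "closedin (top_of_set X) {X1}" using X1 by (simp add: closedin_closed_eq closed_subset)
  moreover have "connected X" using convex by (rule convex_connected)
  ultimately show "X = {X1}" using connected_clopen by blast
qed

end

theorem theorem2:
  fixes X C :: "(real ^ 'd) set"
    and F :: "real ^ 'd \<Rightarrow> real ^ 'd \<Rightarrow> real"
    and N :: "real ^ 'd \<Rightarrow> real"
    and h :: "real ^ 'd \<Rightarrow> ereal"
    and g V :: "real ^ 'd \<Rightarrow> real ^ 'd"
    and x y :: "nat \<Rightarrow> real ^ 'd"
    and \<gamma> \<delta> :: "nat \<Rightarrow> real"
    and X1 xsol :: "real ^ 'd"
    and K H \<nu> :: real
  assumes X: "X \<noteq> {}" "convex X"
    and finsler: "finsler_metric X F" "regular_metric X F"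
    and reference_norm: "is_norm N" "\<nu> > 0" "\<forall>p\<in>X. \<forall>z. F p z \<ge> \<nu> * N z"
    and bregman: "bregman_finsler X F h g K"
    and monotone: "monotone_operator X V"
    and solution: "vi_solution V X xsol"
    and C: "C \<subseteq> X" "convex C" "compact C"
    and neighborhood: "\<exists>U. openin (top_of_set X) U \<and> xsol \<in> U \<and> U \<subseteq> C"
    and X1: "X1 \<in> X"
    and H: "H = (SUP p\<in>C. bregman_div h g p X1)"
    and algorithm: "adaprox X F h g V X1 x y \<gamma> \<delta>"
  shows "(\<forall>M>0. metrically_bounded X F V M \<longrightarrow>
            (\<lambda>T. Gap V C (ergodic_average \<gamma> y T))
              \<in> O(\<lambda>T. (H + M ^ 3 * (1 + 1 / K)\<^sup>2
                        + ln (1 + 4 * M\<^sup>2 * (1 + 2 / K)\<^sup>2 * real T)) / sqrt (real T))) \<and>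
         ((\<exists>L>0. metrically_smooth X F V L) \<longrightarrow>
            (\<lambda>T. Gap V C (ergodic_average \<gamma> y T)) \<in> O(\<lambda>T. H / real T))"
proof -
  interpret run: adaprox_run X F h g K V X1 x y \<gamma> \<delta>
    using X finsler(1) bregman monotone X1 algorithm by unfold_locales
  obtain U where U: "openin (top_of_set X) U" "xsol \<in> U" "U \<subseteq> C"
    using neighborhood by blast
  then have xsol: "xsol \<in> C" by blast
  have H_upper: "bregman_div h g q X1 \<le> H" if "q \<in> C" for q
    unfolding H using run.D_bdd_above[OF C(1,3)] that by (intro cSUP_upper)
  show ?thesis
  proof (intro conjI allI impI)
    fix M :: real assume "M > 0" "metrically_bounded X F V M"
    \<comment> \<open>These two quantities serve as \<open>A\<close> and \<open>c\<close>.\<close>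
    moreover have "M ^ 3 * (1 + 1 / K)\<^sup>2 > 0" "4 * M\<^sup>2 * (1 + 2 / K)\<^sup>2 > 0"
      using \<open>M > 0\<close> run.K_pos by (auto intro!: mult_pos_pos zero_less_power add_pos_pos)
    ultimately show "(\<lambda>T. Gap V C (ergodic_average \<gamma> y T))
              \<in> O(\<lambda>T. (H + M ^ 3 * (1 + 1 / K)\<^sup>2
                        + ln (1 + 4 * M\<^sup>2 * (1 + 2 / K)\<^sup>2 * real T)) / sqrt (real T))"
      using run.gap_bigo_bounded[OF C(1) solution xsol H_upper _ _ finsler(2)] by blast
  next
    assume "\<exists>L>0. metrically_smooth X F V L"
    then obtain L where L: "L > 0" "metrically_smooth X F V L" by blast
    show "(\<lambda>T. Gap V C (ergodic_average \<gamma> y T)) \<in> O(\<lambda>T. H / real T)"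
    proof (cases "H > 0")
      case True
      then show ?thesis
        using run.gap_bigo_smooth[OF C(1) solution xsol H_upper _ L] by blast
    next
      txt \<open>Then \<open>H / T = 0\<close>, so the gap has to vanish; this is where \<open>C\<close> being a neighborhood of the
        solution is needed.\<close>
      case False
      then have "bregman_div h g q X1 \<le> 0" if "q \<in> C" for q using H_upper[OF that] by linarith
      note single = run.singleton_if_radius_zero[OF C(1) U this]
      have "Gap V C (ergodic_average \<gamma> y T) = 0" if T: "T \<ge> 1" for T
      proof -
        have "y t - X1 = 0" if "t \<in> {1..T}" for t using run.y_in[of t] single(1) that by auto
        then have "V X1 \<bullet> (ergodic_average \<gamma> y T - X1) = 0"
          unfolding run.inner_ergodic_average[OF T] by simp
        then show ?thesis by (simp add: Gap_def single(2))
      qed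
      then show ?thesis
        by (intro bigoI[of _ 0]) (auto intro: eventually_mono[OF eventually_ge_at_top[of 1]])
    qed
  qed
qed

end
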